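(* Let $\tau$ be the unique zero in $(1,\infty)$ of the function $$f(t)=\sum_{p\in\mathbb{P}}p^{-t}-1-\bigg(1-\sum_{p\in\mathbb{P}}p^{-2t}\bigg)^{1/2}\qquad(t>1),$$ where $\mathbb{P}$ is the set of all primes. If $t>\tau$, then any set of primes $\mathcal{P}$ is $t$-best among all primitive subsets of $\mathbb{N}(\mathcal{P})$; that is, for every real $t>\tau$, every set of primes $\mathcal{P}$, and every primitive set $\mathcal{S}\subset\mathbb{N}(\mathcal{P})$, $$\sum_{n\in\mathcal{S}}n^{-t}\le\sum_{p\in\mathcal{P}}p^{-t}.$$
   Context: $\mathbb{N}=\{1,2,3,\dots\}$. For a set $\mathcal{P}$ of primes, $\mathbb{N}(\mathcal{P})$ is the set of natural numbers all of whose prime factors lie in $\mathcal{P}$. A nonempty set of natural numbers is called primitive if no element of the set divides another (distinct) element; by convention the singleton $\{1\}$ is not primitive (hence no primitive set contains $1$). The function $f$ is well defined for $t>1$ (since $\sum_p p^{-2}<1$ over all primes), it has a unique zero $\tau=1.1403659\cdots$ in $(1,\infty)$, and it is negative for $t>\tau$. *)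

theory Defs
  imports
    "HOL-Analysis.Analysis"
    "HOL-Computational_Algebra.Primes"
begin

text \<open>
  Infinite sums use \<^const>\<open>infsum\<close>, which is 0 for families that are not summable. All sums
  below are meant for exponents \<open>t > 1\<close>, where they range over positive integers and converge.
\<close>

definition power_sum :: "real \<Rightarrow> nat set \<Rightarrow> real" where
  "power_sum t A = (\<Sum>\<^sub>\<infinity>n\<in>A. real n powr (- t))"

definition smooth_numbers :: "nat set \<Rightarrow> nat set" where
  "smooth_numbers P = {n. n > 0 \<and> prime_factors n \<subseteq> P}"

text \<open>
  By convention \<open>{1}\<close> is not primitive. As 1 divides everything, no primitive set contains 1.
  The type \<^typ>\<open>nat\<close> includes 0, which has to be excluded explicitly.
\<close>

definition primitive :: "nat set \<Rightarrow> bool" where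
  "primitive S \<longleftrightarrow>
     S \<noteq> {} \<and> 0 \<notin> S \<and> S \<noteq> {1} \<and> (\<forall>m\<in>S. \<forall>n\<in>S. m \<noteq> n \<longrightarrow> \<not> m dvd n)"

definition t_best_among_primitive :: "real \<Rightarrow> nat set \<Rightarrow> nat set \<Rightarrow> bool" where
  "t_best_among_primitive t T A \<longleftrightarrow>
     (\<forall>S. S \<subseteq> A \<and> primitive S \<longrightarrow> power_sum t S \<le> power_sum t T)"

definition f :: "real \<Rightarrow> real" where
  "f t = power_sum t {p. prime p} - 1 - sqrt (1 - power_sum (2 * t) {p. prime p})"

text \<open>
  The value of \<open>tau\<close> is meaningful because \<open>f\<close> has exactly one zero in \<open>(1, \<infinity>)\<close>, namely
  \<open>1.1403659\<dots>\<close>.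
\<close>

definition tau :: real where
  "tau = (THE t. t > 1 \<and> f t = 0)"

end

theory Submission
  imports Defs
begin

text \<open>
  Let $x_p = p^{-t}$ and give a natural number the weight $n^{-t}$, the product of the $x_p$ over its
  prime factors with multiplicity. The idea is to push a finite primitive set down, one level of
  the number of prime factors at a time, without losing weight. Replace the elements with the
  largest number of prime factors by their shadow, that is by everything obtained from them by
  dividing by a single prime: the result is again primitive, and after finitely many steps only
  primes are left.

  What has to be shown is that the shadow of a set \<open>A\<close> of numbers that all have the same number of
  prime factors, at least two, weighs at least as much as \<open>A\<close>. On the second level this is elementary: if \<open>R\<close> is the set of
  primes occurring in \<open>A\<close>, then \<open>A\<close> weighs at most $\sum_{p \le q} x_p x_q = (s^2 + v)/2$, where
  $s = \sum x_p$ and $v = \sum x_p^2$ run over \<open>R\<close>, and the shadow weighs \<open>s\<close>. So the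
  inequality $s^2 + v \le 2s$ is what is needed, and for \<open>s \<ge> 1\<close> it says precisely that
  $s \le 1 + \sqrt{1 - v}$, the inequality governed by the function \<open>f\<close>. It passes to subsets of
  the primes, and for \<open>s < 1\<close> the inequality $s^2 + v \le 2s$ holds anyway.

  Higher levels reduce to the second one by double counting
  (lemma \<open>weight_le_weight_shadow\<close>). For each \<open>m\<close> two levels below \<open>A\<close>, apply the inequality to the
  primes \<open>q\<close> for which \<open>mq\<close> lies in the shadow, with $x_q$ on the right and $x_q^2$ on the
  left multiplied by the multiplicity of \<open>q\<close> in \<open>mq\<close>; this is allowed since $x_q \le 1$.
  Summed over \<open>m\<close>, an element \<open>d\<close> of the shadow is counted once for each of its prime factors with multiplicity, a number that is the same for all \<open>d\<close>,
  while each element of \<open>A\<close> is counted at least that often.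

  It remains to see that \<open>tau\<close> really is a zero of \<open>f\<close>: on \<open>t > 1\<close> the function \<open>f\<close> is strictly
  decreasing and continuous, it is nonpositive at 2, and it is positive near 1 because the sum of
  the reciprocals of the primes diverges. Hence \<open>f t < 0\<close> for \<open>t > tau\<close>.
\<close>

section \<open>Weighted antichains of multisets\<close>

definition multiset_weight :: "('a \<Rightarrow> real) \<Rightarrow> 'a multiset \<Rightarrow> real" where
  "multiset_weight x M = prod_mset (image_mset x M)"

definition shadow :: "'a multiset set \<Rightarrow> 'a multiset set" where
  "shadow A = {M - {#a#} | M a. M \<in> A \<and> a \<in># M}"

lemma multiset_weight_add_mset [simp]: "multiset_weight x (add_mset a M) = x a * multiset_weight x M"
  by (simp add: multiset_weight_def)

lemma multiset_weight_nonneg: "(\<And>a. 0 \<le> x a) \<Longrightarrow> 0 \<le> multiset_weight x M"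
  by (induction M) (auto simp: multiset_weight_def)

lemma finite_shadow: "finite A \<Longrightarrow> finite (shadow A)"
proof -
  assume "finite A"
  moreover have "shadow A = (\<Union>M\<in>A. (\<lambda>a. M - {#a#}) ` set_mset M)"
    by (auto simp: shadow_def)
  ultimately show ?thesis by simp
qed

text \<open>
  Up to a factor 2, this bounds from below how often an element of size \<open>k + 2\<close> is counted in
  the double counting for shadows. With \<open>r\<close> distinct elements, the diagonal contributes twice the surplus
  \<open>size M - r\<close> and the off-diagonal pairs contribute \<open>r (r - 1)\<close>; the difference of the two sides
  is \<open>(r - 1) (r - 2)\<close>, which is nonnegative for every integer \<open>r\<close>.
\<close>

lemma sum_pair_multiplicity_ge:
  fixes M :: "'a multiset"
  assumes "M \<noteq> {#}"
  shows "2 * (real (size M) - 1)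
    \<le> (\<Sum>(p, q)\<in>set_mset M \<times> set_mset M. if p = q then 2 * (real (count M p) - 1) else 1)"
proof -
  define r where "r = card (set_mset M)"
  have "(\<Sum>(p, q)\<in>set_mset M \<times> set_mset M. if p = q then 2 * (real (count M p) - 1) else 1)
     = (\<Sum>p\<in>set_mset M. \<Sum>q\<in>set_mset M. if p = q then 2 * (real (count M p) - 1) else 1)"
    by (simp add: sum.cartesian_product)
  also have "\<dots> = (\<Sum>p\<in>set_mset M. 2 * (real (count M p) - 1) + (real r - 1))"
  proof (rule sum.cong[OF refl])
    fix p assume p: "p \<in># M"
    have "(\<Sum>q\<in>set_mset M. if p = q then 2 * (real (count M p) - 1) else 1)
      = 2 * (real (count M p) - 1) + (\<Sum>q\<in>set_mset M - {p}. 1)"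
    proof -
      have "(\<Sum>q\<in>set_mset M - {p}. if p = q then 2 * (real (count M p) - 1) else 1)
        = (\<Sum>q\<in>set_mset M - {p}. 1)"
        by (rule sum.cong) auto
      then show ?thesis using p by (simp only: sum.remove[OF finite_set_mset p]) simp
    qed
    also have "(\<Sum>q\<in>set_mset M - {p}. 1) = real r - 1"
    proof -
      have "0 < card (set_mset M)" using p by (auto simp: card_gt_0_iff)
      then show ?thesis using p by (simp add: r_def of_nat_diff Suc_le_eq)
    qed
    finally show "(\<Sum>q\<in>set_mset M. if p = q then 2 * (real (count M p) - 1) else 1)
      = 2 * (real (count M p) - 1) + (real r - 1)" .
  qed
  also have "\<dots> = 2 * (\<Sum>p\<in>set_mset M. real (count M p)) + real r * (real r - 3)"
    by (simp add: sum.distrib sum_subtractf sum_distrib_left r_def algebra_simps)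
  also have "(\<Sum>p\<in>set_mset M. real (count M p)) = real (size M)"
    by (simp add: size_multiset_overloaded_eq)
  finally have eq: "(\<Sum>(p, q)\<in>set_mset M \<times> set_mset M.
      if p = q then 2 * (real (count M p) - 1) else 1) = 2 * real (size M) + real r * (real r - 3)" .
  have "r \<noteq> 0" using assms by (simp add: r_def)
  then have "r = 1 \<or> 2 \<le> r" by linarith
  then have "0 \<le> (real r - 1) * (real r - 2)"
    by auto
  then show ?thesis unfolding eq by (simp add: algebra_simps)
qed

text \<open>
  The case \<open>c = 0\<close> is the quadratic hypothesis. Raising the multiplicity \<open>c a\<close> by one adds
  \<open>2 (x a)\<^sup>2\<close> on the left and \<open>2 x a\<close> on the right, which is harmless because \<open>x a \<le> 1\<close>.
\<close>

lemma pair_sum_le_with_multiplicities: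
  fixes x :: "'a \<Rightarrow> real" and c :: "'a \<Rightarrow> nat"
  assumes fin: "finite R" and nonneg: "\<And>a. 0 \<le> x a"
    and le1: "\<And>a. a \<in> R \<Longrightarrow> x a \<le> 1"
    and quad: "(\<Sum>a\<in>R. x a)\<^sup>2 + (\<Sum>a\<in>R. (x a)\<^sup>2) \<le> 2 * (\<Sum>a\<in>R. x a)"
  shows "(\<Sum>(p, q)\<in>R \<times> R. x p * x q * (if p = q then 2 * (1 + real (c p)) else 1))
    \<le> 2 * (\<Sum>q\<in>R. x q * (1 + real (c q)))"
proof -
  have "(\<Sum>(p, q)\<in>R \<times> R. x p * x q * (if p = q then 2 * (1 + real (c p)) else 1))
     = (\<Sum>p\<in>R. \<Sum>q\<in>R. x p * x q + (if p = q then (x p)\<^sup>2 * (1 + 2 * real (c p)) else 0))"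
    by (subst sum.cartesian_product[symmetric])
       (auto intro!: sum.cong simp: power2_eq_square algebra_simps)
  also have "\<dots> = (\<Sum>a\<in>R. x a)\<^sup>2 + (\<Sum>a\<in>R. (x a)\<^sup>2) + 2 * (\<Sum>a\<in>R. (x a)\<^sup>2 * real (c a))"
    using fin by (simp add: sum.distrib power2_eq_square sum_product sum_distrib_left algebra_simps)
  also have "\<dots> \<le> 2 * (\<Sum>a\<in>R. x a) + 2 * (\<Sum>a\<in>R. x a * real (c a))"
  proof -
    have "(\<Sum>a\<in>R. (x a)\<^sup>2 * real (c a)) \<le> (\<Sum>a\<in>R. x a * real (c a))"
      using nonneg le1 by (intro sum_mono mult_right_mono) (auto simp: power2_eq_square mult_left_le)
    with quad show ?thesis by linarith
  qed
  also have "\<dots> = 2 * (\<Sum>q\<in>R. x q * (1 + real (c q)))"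
    by (simp add: sum.distrib sum_distrib_left algebra_simps)
  finally show ?thesis .
qed

text \<open>
  Both sides are compared with a sum over triples \<open>(m, p, q)\<close> such that \<open>add_mset p m\<close> and
  \<open>add_mset q m\<close> lie in the shadow \<open>D\<close>, weighted by \<open>x p * x q\<close>, the weight of \<open>m\<close> and the factor
  \<open>h\<close>. Since \<open>p\<close> and \<open>q\<close> are ordered, off-diagonal pairs occur twice; the factor 2 on the
  diagonal compensates for this, and all estimates carry a common factor 2.
\<close>

lemma weight_le_weight_shadow:
  fixes x :: "'a \<Rightarrow> real"
  assumes nonneg: "\<And>a. 0 \<le> x a"
    and quad: "\<And>R. R \<subseteq> Q \<Longrightarrow> finite R \<Longrightarrow> (\<Sum>a\<in>R. x a)\<^sup>2 + (\<Sum>a\<in>R. (x a)\<^sup>2) \<le> 2 * (\<Sum>a\<in>R. x a)"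
    and A: "finite A" "\<And>M. M \<in> A \<Longrightarrow> set_mset M \<subseteq> Q \<and> size M = k + 2"
  shows "(\<Sum>M\<in>A. multiset_weight x M) \<le> (\<Sum>M\<in>shadow A. multiset_weight x M)"
proof -
  \<comment> \<open>The quadratic hypothesis for a singleton reads \<open>2 (x a)\<^sup>2 \<le> 2 x a\<close>.\<close>
  have le1: "x a \<le> 1" if "a \<in> Q" for a
  proof (rule ccontr)
    assume "\<not> x a \<le> 1"
    then have "x a < x a * x a" by simp
    then show False using quad[of "{a}"] that by (simp add: power2_eq_square)
  qed
  define D where "D = shadow A"
  define E where "E = shadow D"
  define R where "R m = {q. add_mset q m \<in> D}" for m
  define h where "h m p q = (if p = q then 2 * (1 + real (count m p)) else 1)" for m :: "'a multiset" and p q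
  have finD: "finite D" "finite E"
    using A(1) by (auto simp: D_def E_def finite_shadow)
  have D: "set_mset d \<subseteq> Q \<and> size d = k + 1" if "d \<in> D" for d
    using that A(2) by (fastforce simp: D_def shadow_def size_Diff_singleton dest: in_diffD)
  have finR: "finite (R m)" and RQ: "R m \<subseteq> Q" for m
  proof -
    show "finite (R m)"
      using finite_vimageI[OF finD(1), of "\<lambda>q. add_mset q m"]
      by (simp add: R_def vimage_def inj_on_def)
    show "R m \<subseteq> Q" using D by (fastforce simp: R_def)
  qed
  have upper: "(\<Sum>m\<in>E. multiset_weight x m * (\<Sum>(p, q)\<in>R m \<times> R m. x p * x q * h m p q))
    \<le> 2 * (real k + 1) * (\<Sum>d\<in>D. multiset_weight x d)"
  proof -
    have "(\<Sum>m\<in>E. multiset_weight x m * (\<Sum>(p, q)\<in>R m \<times> R m. x p * x q * h m p q))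
      \<le> (\<Sum>m\<in>E. multiset_weight x m * (2 * (\<Sum>q\<in>R m. x q * (1 + real (count m q)))))"
      unfolding h_def using RQ finR
      by (intro sum_mono mult_left_mono multiset_weight_nonneg nonneg pair_sum_le_with_multiplicities quad)
         (auto intro: le1)
    also have "\<dots> = 2 * (\<Sum>(m, q)\<in>Sigma E R. multiset_weight x (add_mset q m) * real (count (add_mset q m) q))"
      using finD finR by (simp add: sum.Sigma[symmetric] sum_distrib_left algebra_simps)
    \<comment> \<open>A pair \<open>(m, q)\<close> amounts to an element \<open>d\<close> of the shadow with a chosen member \<open>q\<close>, so that
      the multiplicities add up to the size of \<open>d\<close>.\<close>
    also have "(\<Sum>(m, q)\<in>Sigma E R. multiset_weight x (add_mset q m) * real (count (add_mset q m) q))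
      = (\<Sum>(d, q)\<in>Sigma D set_mset. multiset_weight x d * real (count d q))"
      by (rule sum.reindex_bij_witness[of _ "\<lambda>(d, q). (d - {#q#}, q)" "\<lambda>(m, q). (add_mset q m, q)"])
         (auto simp: R_def E_def shadow_def)
    also have "\<dots> = (\<Sum>d\<in>D. multiset_weight x d * real (size d))"
      using finD by (simp add: sum.Sigma[symmetric] sum_distrib_left[symmetric] size_multiset_overloaded_eq)
    also have "\<dots> = (\<Sum>d\<in>D. multiset_weight x d * (real k + 1))"
      using D by (intro sum.cong) auto
    finally show ?thesis by (simp only: sum_distrib_right[symmetric] mult_ac)
  qed
  have lower: "2 * (real k + 1) * (\<Sum>n\<in>A. multiset_weight x n)
    \<le> (\<Sum>m\<in>E. multiset_weight x m * (\<Sum>(p, q)\<in>R m \<times> R m. x p * x q * h m p q))"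
  proof -
    define T where "T n = {(p, q). {#p, q#} \<subseteq># n}" for n :: "'a multiset"
    have TS: "T n \<subseteq> set_mset n \<times> set_mset n" for n
      by (auto simp: T_def dest: mset_subset_eqD)
    then have finT: "finite (T n)" for n
      by (rule finite_subset) auto
    have "2 * (real k + 1) * (\<Sum>n\<in>A. multiset_weight x n)
      \<le> (\<Sum>n\<in>A. multiset_weight x n * (\<Sum>(p, q)\<in>T n. h (n - {#p, q#}) p q))"
    proof (subst sum_distrib_left, rule sum_mono)
      fix n assume n: "n \<in> A"
      have "2 * (real k + 1) \<le> (\<Sum>(p, q)\<in>set_mset n \<times> set_mset n.
          if p = q then 2 * (real (count n p) - 1) else 1)"
        using sum_pair_multiplicity_ge[of n] A(2)[OF n] by fastforce
      \<comment> \<open>A pair outside \<open>T n\<close> has \<open>p = q\<close> of multiplicity one in \<open>n\<close> and contributes zero.\<close>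
      also have "\<dots> = (\<Sum>(p, q)\<in>T n. h (n - {#p, q#}) p q)"
      proof (rule sum.mono_neutral_cong_right[OF _ TS])
        show "\<forall>i\<in>set_mset n \<times> set_mset n - T n.
          (case i of (p, q) \<Rightarrow> if p = q then 2 * (real (count n p) - 1) else 1) = 0"
        proof (clarify, goal_cases)
          case (1 p q)
          show ?case
          proof (cases "p = q")
            case False
            then have "{#p, q#} \<subseteq># n"
              using 1 by (auto simp: insert_subset_eq_iff in_diff_count)
            with 1 show ?thesis by (simp add: T_def)
          next
            case True
            then have "count n p < 2"
              using 1 by (auto simp: T_def insert_subset_eq_iff in_diff_count not_less_eq_eq)
            with 1 True have "count n p = 1"
              using count_greater_zero_iff[of n p] by linarith
            with True show ?thesis by simp
          qed
        qed
      next
        fix i assume "i \<in> T n"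
        then obtain p q where i: "i = (p, q)" "{#p, q#} \<subseteq># n" by (auto simp: T_def)
        then have "p = q \<Longrightarrow> 2 \<le> count n p"
          using mset_subset_eq_count[OF i(2), of p] by auto
        then show "(case i of (p, q) \<Rightarrow> if p = q then 2 * (real (count n p) - 1) else 1)
          = (case i of (p, q) \<Rightarrow> h (n - {#p, q#}) p q)"
          by (auto simp: i h_def of_nat_diff)
      qed simp
      finally have "2 * (real k + 1) \<le> (\<Sum>(p, q)\<in>T n. h (n - {#p, q#}) p q)" .
      from mult_left_mono[OF this multiset_weight_nonneg[OF nonneg]]
      show "2 * (real k + 1) * multiset_weight x n \<le> multiset_weight x n * (\<Sum>(p, q)\<in>T n. h (n - {#p, q#}) p q)"
        by (simp only: mult.commute)
    qed
    also have "\<dots> = (\<Sum>(n, p, q)\<in>Sigma A T. multiset_weight x n * h (n - {#p, q#}) p q)"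
      by (subst sum.Sigma[symmetric]) (use A(1) finT in \<open>auto simp: sum_distrib_left split_def\<close>)
    also have "\<dots> = (\<Sum>(m, p, q)\<in>(\<lambda>(n, p, q). (n - {#p, q#}, p, q)) ` Sigma A T.
        multiset_weight x m * (x p * x q * h m p q))"
    proof (subst sum.reindex)
      have readd: "add_mset p (add_mset q (n - {#p, q#})) = n" if "(p, q) \<in> T n" for n p q
        using subset_mset.diff_add[of "{#p, q#}" n] that by (simp add: T_def)
      show "inj_on (\<lambda>(n, p, q). (n - {#p, q#}, p, q)) (Sigma A T)"
        by (rule inj_on_inverseI[where g = "\<lambda>(m, p, q). (add_mset p (add_mset q m), p, q)"])
           (auto simp: readd)
      have "multiset_weight x n = multiset_weight x (n - {#p, q#}) * (x p * x q)" if "(p, q) \<in> T n" for n p q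
        using multiset_weight_add_mset[of x p "add_mset q (n - {#p, q#})"] readd[OF that] by (simp add: mult_ac)
      then show "(\<Sum>(n, p, q)\<in>Sigma A T. multiset_weight x n * h (n - {#p, q#}) p q) =
        sum ((\<lambda>(m, p, q). multiset_weight x m * (x p * x q * h m p q)) \<circ> (\<lambda>(n, p, q). (n - {#p, q#}, p, q))) (Sigma A T)"
        by (intro sum.cong) auto
    qed
    \<comment> \<open>Every pair \<open>(p, q)\<close> contained in \<open>n\<close> gives a triple, as removing \<open>q\<close> or \<open>p\<close> from \<open>n\<close> leads to
      an element of the shadow.\<close>
    also have "\<dots> \<le> (\<Sum>(m, p, q)\<in>Sigma E (\<lambda>m. R m \<times> R m). multiset_weight x m * (x p * x q * h m p q))"
    proof (rule sum_mono2)
      show "finite (Sigma E (\<lambda>m. R m \<times> R m))" using finD finR by auto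
      show "(\<lambda>(n, p, q). (n - {#p, q#}, p, q)) ` Sigma A T \<subseteq> Sigma E (\<lambda>m. R m \<times> R m)"
      proof (rule image_subsetI)
        fix i assume "i \<in> Sigma A T"
        then obtain n p q where i: "i = (n, p, q)" "n \<in> A" "{#p, q#} \<subseteq># n"
          by (auto simp: T_def)
        then obtain m where n: "n = add_mset p (add_mset q m)"
          using mset_subset_eq_exists_conv[of "{#p, q#}" n] by (auto simp: T_def)
        have "add_mset q m \<in> D" "add_mset p m \<in> D"
          using i(2) n by (force simp: D_def shadow_def)+
        moreover from this have "m \<in> E" by (force simp: E_def shadow_def)
        ultimately show "(case i of (n, p, q) \<Rightarrow> (n - {#p, q#}, p, q)) \<in> Sigma E (\<lambda>m. R m \<times> R m)"
          by (simp add: i(1) n R_def)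
      qed
      show "0 \<le> (case b of (m, p, q) \<Rightarrow> multiset_weight x m * (x p * x q * h m p q))" for b
        using multiset_weight_nonneg[of x] nonneg by (auto simp: h_def split: prod.split)
    qed
    also have "\<dots> = (\<Sum>m\<in>E. multiset_weight x m * (\<Sum>(p, q)\<in>R m \<times> R m. x p * x q * h m p q))"
      by (subst sum.Sigma[symmetric]) (use finD finR in \<open>auto simp: sum_distrib_left split_def\<close>)
    finally show ?thesis .
  qed
  from lower upper have "2 * (real k + 1) * (\<Sum>n\<in>A. multiset_weight x n) \<le> 2 * (real k + 1) * (\<Sum>d\<in>D. multiset_weight x d)"
    by linarith
  then show ?thesis by (simp add: D_def)
qed

text \<open>
  Induction on the largest size: the top level is replaced by its shadow. An element of the shadow
  lies strictly below a member of the antichain, so it contains no other member, and its size is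
  too large for it to be properly contained in a member of a lower level. Hence the new family is
  again an antichain, and its union with the lower levels is disjoint.
\<close>

lemma antichain_weight_le:
  fixes x :: "'a \<Rightarrow> real"
  assumes nonneg: "\<And>a. 0 \<le> x a"
    and quad: "\<And>R. R \<subseteq> Q \<Longrightarrow> finite R \<Longrightarrow> (\<Sum>a\<in>R. x a)\<^sup>2 + (\<Sum>a\<in>R. (x a)\<^sup>2) \<le> 2 * (\<Sum>a\<in>R. x a)"
    and "finite Q" "finite F"
    and "\<And>M. M \<in> F \<Longrightarrow> M \<noteq> {#} \<and> set_mset M \<subseteq> Q \<and> size M \<le> Suc k"
    and "\<And>M N. M \<in> F \<Longrightarrow> N \<in> F \<Longrightarrow> M \<subseteq># N \<Longrightarrow> M = N"
  shows "(\<Sum>M\<in>F. multiset_weight x M) \<le> (\<Sum>a\<in>Q. x a)"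
  using assms(4-)
proof (induction k arbitrary: F)
  case 0
  have "F \<subseteq> (\<lambda>a. {#a#}) ` Q"
  proof
    fix M assume M: "M \<in> F"
    then have "size M = 1" using 0(2)[OF M] by (auto simp: le_Suc_eq)
    then obtain a where "M = {#a#}" using size_1_singleton_mset by auto
    with 0(2)[OF M] show "M \<in> (\<lambda>a. {#a#}) ` Q" by auto
  qed
  then have "(\<Sum>M\<in>F. multiset_weight x M) \<le> (\<Sum>M\<in>(\<lambda>a. {#a#}) ` Q. multiset_weight x M)"
    using \<open>finite Q\<close> nonneg by (intro sum_mono2 multiset_weight_nonneg) auto
  also have "\<dots> = (\<Sum>a\<in>Q. x a)"
    by (subst sum.reindex) (auto simp: inj_on_def multiset_weight_def)
  finally show ?case .
next
  case (Suc k)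
  define A where "A = {M \<in> F. size M = k + 2}"
  define B where "B = F - A"
  define D where "D = shadow A"
  have fin: "finite A" "finite B" "finite D"
    using Suc.prems(1) by (auto simp: A_def B_def D_def finite_shadow)
  have D: "\<exists>M\<in>A. d \<subset># M" "set_mset d \<subseteq> Q" "size d = Suc k" if "d \<in> D" for d
  proof -
    from that obtain M a where M: "M \<in> A" "a \<in># M" "d = M - {#a#}"
      by (auto simp: D_def shadow_def)
    then have Md: "M = add_mset a d" by simp
    with M(1) show "\<exists>M\<in>A. d \<subset># M" by (intro bexI[of _ M]) simp_all
    have "M \<in> F" "size M = k + 2" using M(1) by (simp_all add: A_def)
    then show "set_mset d \<subseteq> Q" "size d = Suc k"
      using Suc.prems(2)[of M] by (simp_all add: Md)
  qed
  have B: "M \<noteq> {#} \<and> set_mset M \<subseteq> Q \<and> size M \<le> Suc k" if "M \<in> B" for M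
    using Suc.prems(2)[of M] that by (auto simp: A_def B_def)
  have no_sub: "\<not> N \<subseteq># d" "\<not> d \<subseteq># N" if "d \<in> D" "N \<in> B" for d N
  proof -
    from D[OF that(1)] obtain M where M: "M \<in> A" "d \<subset># M" by blast
    show *: "\<not> N \<subseteq># d"
    proof
      assume "N \<subseteq># d"
      then have "N \<subset># M" using M(2) by (rule subset_mset.le_less_trans)
      then show False
        using Suc.prems(3)[of N M] M(1) that(2) by (auto simp: A_def B_def subset_mset.less_le)
    qed
    show "\<not> d \<subseteq># N"
    proof
      assume "d \<subseteq># N"
      then have "d = N"
        using D(3)[OF that(1)] B[OF that(2)] by (metis mset_subset_size not_le subset_mset.le_neq_trans)
      with * show False by simp
    qed
  qed
  have "(\<Sum>M\<in>F. multiset_weight x M) = (\<Sum>M\<in>A. multiset_weight x M) + (\<Sum>M\<in>B. multiset_weight x M)"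
    using Suc.prems(1) unfolding B_def
    by (subst sum.subset_diff[of A]) (auto simp: A_def)
  also have "(\<Sum>M\<in>A. multiset_weight x M) \<le> (\<Sum>M\<in>D. multiset_weight x M)"
    unfolding D_def using Suc.prems(2) fin(1)
    by (intro weight_le_weight_shadow[OF nonneg quad, where k = k and Q = Q]) (auto simp: A_def)
  also have "(\<Sum>M\<in>D. multiset_weight x M) + (\<Sum>M\<in>B. multiset_weight x M) = (\<Sum>M\<in>D \<union> B. multiset_weight x M)"
    using fin no_sub by (intro sum.union_disjoint[symmetric]) auto
  also have "\<dots> \<le> (\<Sum>a\<in>Q. x a)"
  proof (rule Suc.IH)
    show "finite (D \<union> B)" using fin by simp
    show "M \<noteq> {#} \<and> set_mset M \<subseteq> Q \<and> size M \<le> Suc k" if "M \<in> D \<union> B" for M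
      using that B D[of M] by auto
    show "M = N" if MN: "M \<in> D \<union> B" "N \<in> D \<union> B" "M \<subseteq># N" for M N
    proof (cases "M \<in> D"; cases "N \<in> D")
      assume "M \<in> D" "N \<in> D"
      then show ?thesis using D(3) MN(3)
        by (metis mset_subset_size less_irrefl subset_mset.le_neq_trans)
    next
      assume "M \<notin> D" "N \<notin> D"
      then show ?thesis using MN Suc.prems(3) by (auto simp: B_def)
    qed (use MN no_sub in auto)
  qed
  finally show ?case by simp
qed

section \<open>Divergence of the sum of prime reciprocals\<close>

text \<open>
  One half of Euler's product: splitting off the powers of one prime \<open>p\<close> costs a factor
  $1/(1 - 1/p)$, which is at most $e^{2/p}$ because $1/(1 - x) \le 1 + 2x$ for $0 \le x \le 1/2$.
\<close>

lemma sum_inverse_smooth_le_exp: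
  assumes "finite Q" "\<forall>p\<in>Q. prime p" "finite A" "A \<subseteq> smooth_numbers Q"
  shows "(\<Sum>n\<in>A. 1 / real n) \<le> exp (2 * (\<Sum>p\<in>Q. 1 / real p))"
  using assms
proof (induction Q arbitrary: A rule: finite_induct)
  case empty
  have "A \<subseteq> {1}"
  proof
    fix n assume "n \<in> A"
    then have "n > 0" "prime_factorization n = {#}"
      using empty.prems by (auto simp: smooth_numbers_def)
    then show "n \<in> {1}" by (simp add: prime_factorization_empty_iff)
  qed
  then have "(\<Sum>n\<in>A. 1 / real n) \<le> (\<Sum>n\<in>{1}. 1 / real n)"
    by (intro sum_mono2) auto
  then show ?case by simp
next
  case (insert p Q)
  define x where "x = 1 / real p"
  define v where "v n = multiplicity p n" for n :: nat
  define m where "m n = n div p ^ v n" for n :: nat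
  have p: "prime p" using insert.prems by simp
  have x: "0 < x" "x \<le> 1 / 2"
    using prime_ge_2_nat[OF p] by (auto simp: x_def field_simps)
  have n_eq: "n = p ^ v n * m n" for n
    by (simp add: m_def v_def multiplicity_dvd)
  have "m n \<in> smooth_numbers Q" if "n \<in> A" for n
  proof -
    have n: "n > 0" "prime_factors n \<subseteq> insert p Q"
      using that insert.prems by (auto simp: smooth_numbers_def)
    have "m n \<noteq> 0" using n_eq[of n] n(1) by (metis mult_0_right less_irrefl)
    moreover have "\<not> p dvd m n"
      using multiplicity_decompose[of n p] prime_gt_1_nat[OF p] n(1) by (auto simp: m_def v_def)
    moreover have "prime_factors (m n) \<subseteq> prime_factors n"
      using n(1) n_eq[of n] by (intro dvd_prime_factors) (auto, metis dvd_triv_right)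
    ultimately show ?thesis
      using n by (auto simp: smooth_numbers_def in_prime_factors_iff)
  qed
  then have mA: "m ` A \<subseteq> smooth_numbers Q" by blast
  define K where "K = Max (insert 0 (v ` A))"
  have vK: "v n \<le> K" if "n \<in> A" for n
    using that insert.prems(2) by (auto simp: K_def)
  have inj: "inj_on (\<lambda>n. (v n, m n)) A"
    using n_eq by (intro inj_onI) (metis Pair_inject)
  have "(\<Sum>n\<in>A. 1 / real n) = (\<Sum>n\<in>A. x ^ v n * (1 / real (m n)))"
  proof (rule sum.cong[OF refl])
    fix n
    have "real n = real p ^ v n * real (m n)"
      using n_eq[of n] by (metis of_nat_mult of_nat_power)
    then show "1 / real n = x ^ v n * (1 / real (m n))"
      by (simp add: x_def power_divide)
  qed
  also have "\<dots> = (\<Sum>(i, k)\<in>(\<lambda>n. (v n, m n)) ` A. x ^ i * (1 / real k))"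
    by (subst sum.reindex[OF inj]) simp
  also have "\<dots> \<le> (\<Sum>(i, k)\<in>{..K} \<times> m ` A. x ^ i * (1 / real k))"
    using insert.prems(2) x vK by (intro sum_mono2) auto
  also have "\<dots> = (\<Sum>i\<le>K. x ^ i) * (\<Sum>k\<in>m ` A. 1 / real k)"
    by (simp add: sum_product sum.cartesian_product)
  also have "\<dots> \<le> exp (2 * x) * exp (2 * (\<Sum>p\<in>Q. 1 / real p))"
  proof (rule mult_mono)
    have "(\<Sum>i\<le>K. x ^ i) \<le> (\<Sum>i. x ^ i)"
      using x by (intro sum_le_suminf) auto
    also have "\<dots> = 1 / (1 - x)" using x by (intro suminf_geometric) auto
    also have "\<dots> \<le> 1 + 2 * x"
    proof -
      have "0 \<le> x * (1 - 2 * x)" using x by simp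
      then show ?thesis using x by (simp add: field_simps)
    qed
    also have "\<dots> \<le> exp (2 * x)" by (rule exp_ge_add_one_self)
    finally show "(\<Sum>i\<le>K. x ^ i) \<le> exp (2 * x)" .
    show "(\<Sum>k\<in>m ` A. 1 / real k) \<le> exp (2 * (\<Sum>p\<in>Q. 1 / real p))"
      using insert.prems mA by (intro insert.IH) auto
  qed (auto intro: sum_nonneg)
  also have "\<dots> = exp (2 * (\<Sum>p\<in>insert p Q. 1 / real p))"
    using insert.hyps by (simp add: x_def exp_add distrib_left)
  finally show ?case .
qed

text \<open>
  All numbers up to \<open>N\<close> are products of primes up to \<open>N\<close>, so a bound on the prime reciprocals would
  bound the harmonic sums.
\<close>

lemma prime_reciprocal_sums_unbounded:
  "\<exists>Q. finite Q \<and> (\<forall>p\<in>Q. prime p) \<and> c < (\<Sum>p\<in>Q. 1 / real p)"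
proof -
  have "\<exists>N. exp (2 * c) < harm N"
  proof (rule ccontr)
    assume "\<nexists>N. exp (2 * c) < harm N"
    then have "\<forall>N. harm N \<le> exp (2 * c)" by (simp add: not_less)
    moreover have "incseq (harm :: nat \<Rightarrow> real)" by (intro monoI harm_mono)
    ultimately have "convergent (harm :: nat \<Rightarrow> real)"
      by (metis incseq_convergent convergentI)
    then show False using not_convergent_harm by blast
  qed
  then obtain N where N: "exp (2 * c) < harm N" by blast
  define Q where "Q = {p. prime p \<and> p \<le> N}"
  have "{1..N} \<subseteq> smooth_numbers Q"
    by (auto simp: smooth_numbers_def Q_def in_prime_factors_iff dest!: dvd_imp_le)
  moreover have "finite Q" by (rule finite_subset[of _ "{..N}"]) (auto simp: Q_def)
  ultimately have "(\<Sum>n\<in>{1..N}. 1 / real n) \<le> exp (2 * (\<Sum>p\<in>Q. 1 / real p))"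
    by (intro sum_inverse_smooth_le_exp) (auto simp: Q_def)
  with N have "exp (2 * c) < exp (2 * (\<Sum>p\<in>Q. 1 / real p))"
    unfolding harm_def inverse_eq_divide by linarith
  with \<open>finite Q\<close> show ?thesis by (intro exI[of _ Q]) (auto simp: Q_def)
qed

section \<open>The prime zeta function and the number tau\<close>

lemma summable_on_powr_nat:
  assumes "1 < t"
  shows "(\<lambda>n. real n powr (- t)) summable_on (A :: nat set)"
proof -
  have "(\<lambda>n::nat. real n powr (- t)) summable_on UNIV"
    using assms by (intro norm_summable_imp_summable_on) (simp add: summable_real_powr_iff)
  then show ?thesis by (rule summable_on_subset_banach) simp
qed

lemma sum_le_power_sum:
  assumes "1 < t" "finite F" "F \<subseteq> A"
  shows "(\<Sum>n\<in>F. real n powr (- t)) \<le> power_sum t A"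
  unfolding power_sum_def using assms by (intro finite_sum_le_infsum summable_on_powr_nat) auto

lemma power_sum_primes_strict_antimono:
  assumes "1 < s" "s < t"
  shows "power_sum t {p. prime p} < power_sum s {p. prime p}"
  unfolding power_sum_def
proof (rule has_sum_strict_mono[OF has_sum_infsum has_sum_infsum])
  show "(2::nat) \<in> {p. prime p}" by simp
  show "real p powr - t \<le> real p powr - s" if "p \<in> {p. prime p}" for p
    using that assms prime_gt_0_nat[of p] by (intro powr_mono) (auto simp: Suc_le_eq)
  show "real 2 powr - t < real 2 powr - s" using assms by simp
qed (use assms in \<open>auto intro: summable_on_powr_nat\<close>)

text \<open>
  Both terms of \<open>f\<close> decrease. The second one does so whatever the sign of the radicand,
  because \<^const>\<open>sqrt\<close> is the odd extension of the square root and thus monotone on all reals.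
\<close>

lemma f_strict_antimono:
  assumes "1 < s" "s < t"
  shows "f t < f s"
proof -
  have "sqrt (1 - power_sum (2 * s) {p. prime p}) \<le> sqrt (1 - power_sum (2 * t) {p. prime p})"
    using power_sum_primes_strict_antimono[of "2 * s" "2 * t"] assms by simp
  with power_sum_primes_strict_antimono[OF assms] show ?thesis unfolding f_def by linarith
qed

lemma continuous_on_power_sum_primes:
  assumes "1 < a"
  shows "continuous_on {a..} (\<lambda>t. power_sum t {p. prime p})"
proof -
  have "uniform_limit {a..} (\<lambda>F t. \<Sum>p\<in>F. real p powr (- t))
    (\<lambda>t. \<Sum>\<^sub>\<infinity>p\<in>{p. prime p}. real p powr (- t)) (finite_subsets_at_top {p. prime p})"
  proof (rule Weierstrass_m_test_general)
    show "(\<lambda>p. real p powr (- a)) summable_on {p. prime p}"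
      using assms by (rule summable_on_powr_nat)
    show "norm (real p powr - t) \<le> real p powr - a" if "p \<in> {p. prime p}" "t \<in> {a..}" for p t
      using that prime_gt_0_nat[of p] by (auto intro!: powr_mono simp: Suc_le_eq)
  qed
  then show ?thesis unfolding power_sum_def
  proof (rule uniform_limit_theorem[rotated])
    have "continuous_on {a..} (\<lambda>t. \<Sum>p\<in>F. real p powr (- t))"
      if "F \<subseteq> {p. prime p}" for F
      using that by (auto intro!: continuous_intros dest: prime_gt_0_nat)
    then show "\<forall>\<^sub>F F in finite_subsets_at_top {p. prime p}.
        continuous_on {a..} (\<lambda>t. \<Sum>p\<in>F. real p powr (- t))"
      by (auto intro: eventually_finite_subsets_at_top_weakI)
  qed simp
qed

lemma continuous_on_f:
  assumes "1 < a"
  shows "continuous_on {a..} f"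
proof -
  have "continuous_on {a..} (\<lambda>t. power_sum (2 * t) {p. prime p})"
    by (rule continuous_on_compose2[OF continuous_on_power_sum_primes[OF assms]])
       (use assms in \<open>auto intro!: continuous_intros\<close>)
  then show ?thesis unfolding f_def[abs_def]
    by (intro continuous_intros continuous_on_power_sum_primes assms)
qed

text \<open>
  Telescoping, by comparison with $1/(n (n - 1))$. The resulting bound 1 for the prime zeta
  function at exponents from 2 on makes the radicand in \<open>f\<close> nonnegative and yields \<open>f 2 \<le> 0\<close>.
\<close>

lemma sum_inverse_squares_le:
  assumes "1 \<le> (N::nat)"
  shows "(\<Sum>n\<in>{2..N}. 1 / (real n)\<^sup>2) \<le> 1 - 1 / real N"
  using assms
proof (induction N rule: dec_induct)
  case (step N)
  have "1 / (real (Suc N))\<^sup>2 \<le> 1 / (real N * real (Suc N))"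
    using step by (intro divide_left_mono) (auto simp: power2_eq_square)
  also have "\<dots> = 1 / real N - 1 / real (Suc N)"
    using step by (simp add: field_simps)
  finally show ?case using step by simp
qed simp

lemma power_sum_primes_le_1:
  assumes "2 \<le> t"
  shows "power_sum t {p. prime p} \<le> 1"
  unfolding power_sum_def
proof (rule infsum_le_finite_sums[OF summable_on_powr_nat])
  fix F :: "nat set" assume F: "finite F" "F \<subseteq> {p. prime p}"
  define N where "N = Max (insert 1 F)"
  have sub: "F \<subseteq> {2..N}" and N: "1 \<le> N"
    using F prime_ge_2_nat by (auto simp: N_def)
  have "(\<Sum>p\<in>F. real p powr - t) \<le> (\<Sum>p\<in>F. 1 / (real p)\<^sup>2)"
  proof (rule sum_mono)
    fix p assume "p \<in> F"
    then have "1 \<le> real p" using sub by auto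
    then have "real p powr - t \<le> real p powr - 2" using assms by (intro powr_mono) auto
    also have "\<dots> = 1 / (real p)\<^sup>2" using \<open>1 \<le> real p\<close> by (simp add: powr_minus_divide powr_numeral)
    finally show "real p powr - t \<le> 1 / (real p)\<^sup>2" .
  qed
  also have "\<dots> \<le> (\<Sum>n\<in>{2..N}. 1 / (real n)\<^sup>2)"
    using sub by (intro sum_mono2) auto
  also have "\<dots> \<le> 1 - 1 / real N" using N by (rule sum_inverse_squares_le)
  also have "\<dots> \<le> 1" by simp
  finally show "(\<Sum>p\<in>F. real p powr - t) \<le> 1" .
qed (use assms in simp)

lemma f_2_nonpos: "f 2 \<le> 0"
proof -
  have "0 \<le> sqrt (1 - power_sum 4 {p. prime p})"
    using power_sum_primes_le_1[of 4] by simp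
  moreover have "f 2 = power_sum 2 {p. prime p} - 1 - sqrt (1 - power_sum 4 {p. prime p})"
    by (simp add: f_def)
  ultimately show ?thesis using power_sum_primes_le_1[of 2] by linarith
qed

text \<open>
  As the square root is at most 1, it suffices that the prime zeta function exceeds 2. This already
  holds for a suitable finite partial sum at exponent 1, hence by continuity at exponents
  slightly above 1.
\<close>

lemma f_pos_near_1: "\<exists>s. 1 < s \<and> s < 2 \<and> 0 < f s"
proof -
  obtain Q where Q: "finite Q" "\<forall>p\<in>Q. prime p" "2 < (\<Sum>p\<in>Q. 1 / real p)"
    using prime_reciprocal_sums_unbounded by blast
  let ?S = "\<lambda>s::real. \<Sum>p\<in>Q. real p powr (- s)"
  have pos: "0 < p" if "p \<in> Q" for p
    using Q(2) that prime_gt_0_nat by blast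
  have "(?S \<longlongrightarrow> ?S 1) (at_right 1)"
    using pos by (intro tendsto_intros) auto
  moreover have "?S 1 = (\<Sum>p\<in>Q. 1 / real p)"
    using pos by (intro sum.cong) (auto simp: powr_minus_divide)
  ultimately have "\<forall>\<^sub>F s in at_right 1. 2 < ?S s"
    using Q(3) by (auto simp: order_tendsto_iff)
  moreover have "\<forall>\<^sub>F s in at_right (1::real). s \<in> {1<..<2}"
    by (rule eventually_at_right_real) simp
  ultimately have "\<forall>\<^sub>F s in at_right (1::real). 2 < ?S s \<and> s \<in> {1<..<2}"
    by (rule eventually_conj)
  then obtain s where s: "2 < ?S s" "1 < s" "s < 2"
    using eventually_happens[of _ "at_right (1::real)"] by force
  have "2 < power_sum s {p. prime p}"
  proof (rule less_le_trans[OF s(1) sum_le_power_sum])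
    show "Q \<subseteq> {p. prime p}" using Q(2) by blast
  qed (use s Q(1) in auto)
  moreover have "0 \<le> power_sum (2 * s) {p. prime p}"
    unfolding power_sum_def by (rule infsum_nonneg) simp
  then have "sqrt (1 - power_sum (2 * s) {p. prime p}) \<le> 1" by simp
  ultimately have "0 < f s" unfolding f_def by linarith
  then show ?thesis using s by blast
qed

lemma tau_zero: "1 < tau" "f tau = 0"
proof -
  obtain s where s: "1 < s" "s < 2" "0 < f s" using f_pos_near_1 by blast
  have "continuous_on {s..2} f"
    using continuous_on_f[OF s(1)] by (rule continuous_on_subset) auto
  then obtain z where z: "s \<le> z" "f z = 0"
    using IVT2'[of f 2 0 s] f_2_nonpos s by auto
  have "1 < tau \<and> f tau = 0" unfolding tau_def
  proof (rule theI[of _ z])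
    show "y = z" if "1 < y \<and> f y = 0" for y
      using that z s f_strict_antimono[of y z] f_strict_antimono[of z y] by force
  qed (use z s in auto)
  then show "1 < tau" "f tau = 0" by auto
qed

text \<open>
  With \<open>s\<close> and \<open>v\<close> the two sums over \<open>R\<close>, the claim is \<open>(s - 1)\<^sup>2 \<le> 1 - v\<close>. For \<open>s \<ge> 1\<close> this
  is the squared form of \<open>f t < 0\<close>: passing from all primes to \<open>R\<close> decreases \<open>s\<close> and increases
  \<open>1 - v\<close>. For \<open>s < 1\<close> it holds trivially, since then both \<open>s\<^sup>2\<close> and \<open>v\<close> are at most \<open>s\<close>.
\<close>

lemma sum_primes_powr_quadratic:
  assumes "tau < t" "finite R" "R \<subseteq> {p. prime p}"
  shows "(\<Sum>p\<in>R. real p powr (- t))\<^sup>2 + (\<Sum>p\<in>R. (real p powr (- t))\<^sup>2)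
    \<le> 2 * (\<Sum>p\<in>R. real p powr (- t))"
proof -
  define s where "s = (\<Sum>p\<in>R. real p powr (- t))"
  define v where "v = (\<Sum>p\<in>R. (real p powr (- t))\<^sup>2)"
  have t: "1 < t" using assms(1) tau_zero(1) by simp
  have x: "real p powr - t \<le> 1" if "p \<in> R" for p
  proof -
    have "1 \<le> real p" using that assms(3) prime_ge_2_nat[of p] by auto
    then show ?thesis using t powr_mono[of "- t" 0 "real p"] by simp
  qed
  have v_le: "v \<le> power_sum (2 * t) {p. prime p}"
    using sum_le_power_sum[of "2 * t" R "{p. prime p}"] t assms
    by (simp add: v_def power2_eq_square powr_add[symmetric])
  have "f t < 0" using f_strict_antimono[OF tau_zero(1) assms(1)] tau_zero(2) by simp
  then have "s - 1 \<le> sqrt (1 - power_sum (2 * t) {p. prime p})"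
    using sum_le_power_sum[OF t assms(2,3)] by (simp add: f_def s_def)
  also have "\<dots> \<le> sqrt (1 - v)" using v_le by simp
  finally have s_le: "s - 1 \<le> sqrt (1 - v)" .
  have "v \<le> 1"
    using v_le power_sum_primes_le_1[of "2 * t"] t by simp
  have "s\<^sup>2 + v \<le> 2 * s"
  proof (cases "1 \<le> s")
    case True
    then have "(s - 1)\<^sup>2 \<le> (sqrt (1 - v))\<^sup>2" using s_le by (intro power_mono) auto
    then show ?thesis using \<open>v \<le> 1\<close> by (simp add: power2_eq_square algebra_simps)
  next
    case False
    have "0 \<le> s" by (auto simp: s_def intro: sum_nonneg)
    then have "s\<^sup>2 \<le> s" using False by (simp add: power2_eq_square mult_left_le)
    moreover have "v \<le> s"
      unfolding v_def s_def using x by (intro sum_mono) (simp add: power2_eq_square mult_left_le)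
    ultimately show ?thesis by simp
  qed
  then show ?thesis by (simp add: s_def v_def)
qed


section \<open>From multisets to primitive sets\<close>

lemma multiset_weight_prime_factorization:
  assumes "0 < n"
  shows "multiset_weight (\<lambda>p. real p powr (- t)) (prime_factorization n) = real n powr (- t)"
proof -
  have "multiset_weight (\<lambda>p. real p powr (- t)) M = real (prod_mset M) powr (- t)" for M
    by (induction M) (simp_all add: multiset_weight_def powr_mult)
  then show ?thesis using assms by (simp add: prod_mset_prime_factorization_nat)
qed

text \<open>
  Prime factorization turns divisibility into inclusion of multisets, hence a primitive set into an
  antichain of nonempty multisets.
\<close>

lemma finite_primitive_sum_le:
  assumes t: "tau < t" and P: "\<forall>p\<in>P. prime p" and F: "finite F" "F \<subseteq> smooth_numbers P" "1 \<notin> F"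
    and anti: "\<And>m n. m \<in> F \<Longrightarrow> n \<in> F \<Longrightarrow> m dvd n \<Longrightarrow> m = n"
  shows "(\<Sum>n\<in>F. real n powr (- t)) \<le> power_sum t P"
proof -
  define Q where "Q = (\<Union>n\<in>F. prime_factors n)"
  define G where "G = prime_factorization ` F"
  have pos: "0 < n" if "n \<in> F" for n using that F(2) by (auto simp: smooth_numbers_def)
  have Q: "finite Q" "Q \<subseteq> P" using F by (auto simp: Q_def smooth_numbers_def)
  have dvd: "prime_factorization m \<subseteq># prime_factorization n \<longleftrightarrow> m dvd n" if "m \<in> F" "n \<in> F" for m n
    using pos that by (intro prime_factorization_subset_iff_dvd) auto
  have inj: "inj_on prime_factorization F"
    using dvd anti by (metis inj_onI subset_mset.order_refl)
  have "(\<Sum>n\<in>F. real n powr (- t)) = (\<Sum>M\<in>G. multiset_weight (\<lambda>p. real p powr (- t)) M)"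
    unfolding G_def by (subst sum.reindex[OF inj]) (simp add: multiset_weight_prime_factorization pos)
  also have "\<dots> \<le> (\<Sum>p\<in>Q. real p powr (- t))"
  proof (rule antichain_weight_le[where k = "\<Sum>M\<in>G. size M"])
    show "(\<Sum>p\<in>R. real p powr (- t))\<^sup>2 + (\<Sum>p\<in>R. (real p powr (- t))\<^sup>2)
        \<le> 2 * (\<Sum>p\<in>R. real p powr (- t))" if "R \<subseteq> Q" "finite R" for R
      using that Q P by (intro sum_primes_powr_quadratic[OF t]) auto
    show "finite G" using F(1) by (simp add: G_def)
    show "M \<noteq> {#} \<and> set_mset M \<subseteq> Q \<and> size M \<le> Suc (\<Sum>M\<in>G. size M)" if "M \<in> G" for M
    proof (intro conjI)
      from \<open>M \<in> G\<close> obtain n where n: "n \<in> F" "M = prime_factorization n"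
        unfolding G_def by blast
      have "n \<noteq> 1" "n \<noteq> 0" using n F(3) pos[of n] by auto
      then show "M \<noteq> {#}" by (simp add: n prime_factorization_empty_iff)
      show "set_mset M \<subseteq> Q" using n by (auto simp: Q_def)
      show "size M \<le> Suc (\<Sum>M\<in>G. size M)"
        using member_le_sum[of M G size] that \<open>finite G\<close> by simp
    qed
    show "M = N" if "M \<in> G" "N \<in> G" "M \<subseteq># N" for M N
      using that dvd anti by (auto simp: G_def)
  qed (use Q in auto)
  also have "\<dots> \<le> power_sum t P"
    using Q t tau_zero(1) by (intro sum_le_power_sum) auto
  finally show ?thesis .
qed

theorem corollary7:
  fixes t :: real and P :: "nat set"
  assumes "t > tau"
    and "\<forall>p\<in>P. prime p"
  shows "t_best_among_primitive t P (smooth_numbers P)"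
  unfolding t_best_among_primitive_def
proof (intro allI impI)
  fix S assume "S \<subseteq> smooth_numbers P \<and> primitive S"
  then have S: "S \<subseteq> smooth_numbers P" "primitive S" by auto
  have "1 \<notin> S"
  proof
    assume "1 \<in> S"
    then have "S = {1}" using S(2) one_dvd by (fastforce simp: primitive_def)
    then show False using S(2) by (simp add: primitive_def)
  qed
  show "power_sum t S \<le> power_sum t P"
    unfolding power_sum_def[of t S]
  proof (rule infsum_le_finite_sums[OF summable_on_powr_nat])
    show "1 < t" using assms(1) tau_zero(1) by simp
    show "(\<Sum>n\<in>F. real n powr - t) \<le> power_sum t P" if "finite F" "F \<subseteq> S" for F
      using that S \<open>1 \<notin> S\<close> by (intro finite_primitive_sum_le assms) (auto simp: primitive_def)
  qed
qed

end
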